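(* Let $p,q$ be squarefree positive integers such that $K=\mathbb{Q}(\sqrt p,\sqrt q)$ is a biquadratic number field, and let $r=\frac{pq}{\gcd(p,q)^2}$. Let $$Q(\mathbf{x})=\sum_{i,j=1}^{n}\alpha_{ij}x_ix_j$$ be a classical totally positive definite quadratic form with coefficients from $\mathcal{O}_K$ (so $\alpha_{ij}=\alpha_{ji}\in\mathcal{O}_K$). Then $$\alpha_{ij}^2\prec\alpha_{ii}\alpha_{jj}$$ for every $i\neq j$. If $\alpha_{ij}=a_{ij}+b_{ij}\sqrt p+c_{ij}\sqrt q+d_{ij}\sqrt r$ for some $a_{ij},b_{ij},c_{ij},d_{ij}\in\mathbb{Q}$ (with $i\neq j$), then $$a_{ij}^2\leq\frac14\mathrm{Tr}(\alpha_{ii}\alpha_{jj}),\quad b_{ij}^2\leq\frac1{4p}\mathrm{Tr}(\alpha_{ii}\alpha_{jj}),\quad c_{ij}^2\leq\frac1{4q}\mathrm{Tr}(\alpha_{ii}\alpha_{jj}),\quad d_{ij}^2\leq\frac1{4r}\mathrm{Tr}(\alpha_{ii}\alpha_{jj}).$$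
   Context: $\mathcal{O}_K$ is the ring of integers of $K$. For $\alpha,\beta\in K$, $\alpha\succ0$ (totally positive) means $\sigma(\alpha)>0$ for every embedding $\sigma:K\to\mathbb{C}$, and $\beta\prec\alpha$ means $\alpha-\beta\succ0$. $\mathrm{Tr}(\alpha)=\sum_\sigma\sigma(\alpha)$ is the trace from $K$ to $\mathbb{Q}$. A quadratic form is classical if all entries of its associated symmetric matrix $(\alpha_{ij})_{i,j=1}^n$ lie in $\mathcal{O}_K$; it is totally positive definite if $Q(\gamma_1,\dots,\gamma_n)\succ0$ whenever $\gamma_1,\dots,\gamma_n\in\mathcal{O}_K$ are not all zero. A biquadratic field $\mathbb{Q}(\sqrt p,\sqrt q)$ has degree 4 over $\mathbb{Q}$. *)

theory Defs
  imports
    Complex_Main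
    "HOL-Algebra.Generated_Fields"
    "HOL-Algebra.Algebraic_Closure_Type"
    "HOL-Library.Complex_Order"
    "HOL-Computational_Algebra.Squarefree"
begin

text \<open>
  Subfields of the reals are sets of reals. The constant \<^const>\<open>ring_of_type_algebra\<close> is the
  type-class ring structure on a whole type, viewed as a record.
\<close>

definition adjoin_rat :: "real set \<Rightarrow> real set" where
  "adjoin_rat S = generate_field ring_of_type_algebra S"

definition degree_over_rat :: "real set \<Rightarrow> nat" where
  "degree_over_rat K = vector_space.dim (\<lambda>(c::rat) (x::real). of_rat c * x) K"

definition ring_of_integers :: "real set \<Rightarrow> real set" where
  "ring_of_integers K = {x \<in> K. algebraic_int x}"

text \<open>
  Embeddings are required to be \<^const>\<open>undefined\<close> outside \<open>K\<close>, so that each embedding of \<open>K\<close> is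
  represented by exactly one function on the reals.
\<close>

definition embeddings :: "real set \<Rightarrow> (real \<Rightarrow> complex) set" where
  "embeddings K = ring_hom (ring_of_type_algebra\<lparr>carrier := K\<rparr>) ring_of_type_algebra \<inter> extensional K"

text \<open>
  In the order on the complex numbers, \<open>0 < z\<close> means that \<open>z\<close> is real and positive.
\<close>

definition totally_positive :: "real set \<Rightarrow> real \<Rightarrow> bool" where
  "totally_positive K \<alpha> \<longleftrightarrow> (\<forall>\<sigma> \<in> embeddings K. 0 < \<sigma> \<alpha>)"

definition totally_less :: "real set \<Rightarrow> real \<Rightarrow> real \<Rightarrow> bool" where
  "totally_less K \<beta> \<alpha> \<longleftrightarrow> totally_positive K (\<alpha> - \<beta>)"

definition field_trace :: "real set \<Rightarrow> real \<Rightarrow> rat" where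
  "field_trace K \<alpha> = (THE t. of_rat t = (\<Sum>\<sigma>\<in>embeddings K. \<sigma> \<alpha>))"

text \<open>
  A quadratic form in the variables \<open>x\<^sub>1, \<dots>, x\<^sub>n\<close> is given by its symmetric matrix; only the entries
  and coordinates with indices in \<open>{1..n}\<close> are meaningful.
\<close>

definition quad_form :: "nat \<Rightarrow> (nat \<Rightarrow> nat \<Rightarrow> real) \<Rightarrow> (nat \<Rightarrow> real) \<Rightarrow> real" where
  "quad_form n \<alpha> x = (\<Sum>i\<in>{1..n}. \<Sum>j\<in>{1..n}. \<alpha> i j * x i * x j)"

definition classical_form :: "real set \<Rightarrow> nat \<Rightarrow> (nat \<Rightarrow> nat \<Rightarrow> real) \<Rightarrow> bool" where
  "classical_form K n \<alpha> \<longleftrightarrow>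
     (\<forall>i\<in>{1..n}. \<forall>j\<in>{1..n}. \<alpha> i j = \<alpha> j i \<and> \<alpha> i j \<in> ring_of_integers K)"

definition totally_positive_definite :: "real set \<Rightarrow> nat \<Rightarrow> (nat \<Rightarrow> nat \<Rightarrow> real) \<Rightarrow> bool" where
  "totally_positive_definite K n \<alpha> \<longleftrightarrow>
     (\<forall>\<gamma>. (\<forall>i\<in>{1..n}. \<gamma> i \<in> ring_of_integers K) \<and> (\<exists>i\<in>{1..n}. \<gamma> i \<noteq> 0) \<longrightarrow>
        totally_positive K (quad_form n \<alpha> \<gamma>))"

end

theory Submission
  imports Defs
begin

text \<open>
  Evaluating the form at an integral vector supported on \<open>{i, j}\<close> that completes the square shows that
  \<open>\<alpha>\<^sub>i\<^sub>i \<alpha>\<^sub>j\<^sub>j - \<alpha>\<^sub>i\<^sub>j\<^sup>2\<close> is totally positive, so it has positive trace. The four embeddings of \<open>K\<close> change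
  the signs of \<open>\<surd>p\<close> and \<open>\<surd>q\<close> independently, hence the trace of \<open>(a + b \<surd>p + c \<surd>q + d \<surd>r)\<^sup>2\<close> is
  \<open>4 (a\<^sup>2 + p b\<^sup>2 + q c\<^sup>2 + r d\<^sup>2)\<close>, and each summand is bounded by the trace of \<open>\<alpha>\<^sub>i\<^sub>i \<alpha>\<^sub>j\<^sub>j\<close>.
\<close>

section \<open>Subfields of a type-class field\<close>

lemma ring_of_type_algebra_simps [simp]:
  "carrier ring_of_type_algebra = UNIV"
  "\<one>\<^bsub>ring_of_type_algebra\<^esub> = 1"
  "\<zero>\<^bsub>ring_of_type_algebra\<^esub> = 0"
  "x \<oplus>\<^bsub>ring_of_type_algebra\<^esub> y = x + y"
  "x \<otimes>\<^bsub>ring_of_type_algebra\<^esub> y = x * y"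
  by (simp_all add: ring_of_type_algebra_def)

lemma a_inv_ring_of_type_algebra [simp]:
  fixes x :: "'a::Fields.field"
  shows "\<ominus>\<^bsub>ring_of_type_algebra\<^esub> x = - x"
proof -
  interpret R: field "ring_of_type_algebra :: 'a ring"
    by (rule field_from_type_algebra)
  show ?thesis
    by (metis R.minus_equality UNIV_I ab_left_minus ring_of_type_algebra_simps(1,3,4))
qed

lemma m_inv_ring_of_type_algebra [simp]:
  fixes x :: "'a::Fields.field"
  assumes "x \<noteq> 0"
  shows "inv\<^bsub>ring_of_type_algebra\<^esub> x = inverse x"
proof -
  interpret R: field "ring_of_type_algebra :: 'a ring"
    by (rule field_from_type_algebra)
  show ?thesis
    using assms
    by (metis R.inv_unique' UNIV_I left_inverse mult.commute ring_of_type_algebra_simps(1,2,5))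
qed

lemma subfield_type_algebraI:
  fixes F :: "'a::Fields.field set"
  assumes one: "1 \<in> F" and neg: "\<And>x. x \<in> F \<Longrightarrow> - x \<in> F"
    and inv: "\<And>x. x \<in> F \<Longrightarrow> x \<noteq> 0 \<Longrightarrow> inverse x \<in> F"
    and add: "\<And>x y. x \<in> F \<Longrightarrow> y \<in> F \<Longrightarrow> x + y \<in> F"
    and mult: "\<And>x y. x \<in> F \<Longrightarrow> y \<in> F \<Longrightarrow> x * y \<in> F"
  shows "subfield F ring_of_type_algebra"
proof -
  interpret R: field "ring_of_type_algebra :: 'a ring"
    by (rule field_from_type_algebra)
  show ?thesis
    by (intro R.subfieldI' R.subringI) (auto simp: assms)
qed

lemma subfield_type_algebraD:
  fixes F :: "'a::Fields.field set"
  assumes "subfield F ring_of_type_algebra"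
  shows "0 \<in> F" "1 \<in> F" "x \<in> F \<Longrightarrow> - x \<in> F" "x \<in> F \<Longrightarrow> inverse x \<in> F"
    "x \<in> F \<Longrightarrow> y \<in> F \<Longrightarrow> x + y \<in> F" "x \<in> F \<Longrightarrow> y \<in> F \<Longrightarrow> x * y \<in> F"
proof -
  interpret R: field "ring_of_type_algebra :: 'a ring"
    by (rule field_from_type_algebra)
  note sub = subfieldE(1)[OF assms]
  show zero: "0 \<in> F" and "1 \<in> F" "x \<in> F \<Longrightarrow> - x \<in> F"
    "x \<in> F \<Longrightarrow> y \<in> F \<Longrightarrow> x + y \<in> F" "x \<in> F \<Longrightarrow> y \<in> F \<Longrightarrow> x * y \<in> F"
    using subringE(2,3,5,6,7)[OF sub] by simp_all
  \<comment> \<open>Since \<open>inverse 0 = 0\<close>, closure under \<open>inverse\<close> holds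
    at zero as well.\<close>
  show "x \<in> F \<Longrightarrow> inverse x \<in> F"
    using R.subfield_m_inv(1)[OF assms, of x] zero by (cases "x = 0") auto
qed

lemma subfield_adjoin_rat: "subfield (adjoin_rat S) ring_of_type_algebra"
proof -
  interpret R: field "ring_of_type_algebra :: real ring"
    by (rule field_from_type_algebra)
  show ?thesis
    unfolding adjoin_rat_def by (rule R.generate_field_is_subfield) simp
qed

lemma adjoin_rat_superset: "S \<subseteq> adjoin_rat S"
  by (auto simp: adjoin_rat_def intro: generate_field.incl)

lemma adjoin_rat_least:
  assumes "subfield F ring_of_type_algebra" "S \<subseteq> F"
  shows "adjoin_rat S \<subseteq> F"
proof -
  interpret R: field "ring_of_type_algebra :: real ring"
    by (rule field_from_type_algebra)
  show ?thesis
    unfolding adjoin_rat_def using assms by (intro R.generate_field_min_subfield1) auto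
qed

text \<open>Starting from 1, addition gives the naturals, negation the integers and inverses the
  quotients. Hence \<open>adjoin_rat S\<close> contains the rationals although only \<open>S\<close>
  generates it.\<close>

lemma of_rat_in_subfield:
  fixes F :: "'a::field_char_0 set"
  assumes "subfield F ring_of_type_algebra"
  shows "of_rat a \<in> F"
proof (cases a)
  case (Fract m n)
  note F = subfield_type_algebraD[OF assms]
  have nat: "of_nat k \<in> F" for k
    by (induction k) (use F in auto)
  have int: "of_int i \<in> F" for i
    using nat[of "nat i"] F(3)[OF nat[of "nat (- i)"]] by (cases "i \<ge> 0") auto
  have "of_rat a = (of_int m / of_int n :: 'a)"
    using Fract by (simp add: Fract_of_int_quotient of_rat_divide)
  then show ?thesis
    using F(6)[OF int[of m] F(4)[OF int[of n]]] by (simp add: divide_inverse)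
qed

text \<open>
  If \<open>A - B w = 0\<close> then \<open>A + B w = 2 A\<close>, so inverses exist even when \<open>w\<close> already lies in \<open>F\<close>.
\<close>

lemma subfield_adjoin_square_root:
  fixes F :: "'a::field_char_0 set"
  assumes F: "subfield F ring_of_type_algebra" and w: "w * w \<in> F"
  shows "subfield {A + B * w | A B. A \<in> F \<and> B \<in> F} ring_of_type_algebra" (is "subfield ?E _")
proof (rule subfield_type_algebraI)
  note FD = subfield_type_algebraD[OF F]
  have diff: "x - y \<in> F" if "x \<in> F" "y \<in> F" for x y
    using FD(5)[OF that(1) FD(3)[OF that(2)]] by simp
  have E: "x \<in> ?E" if "x = A + B * w" "A \<in> F" "B \<in> F" for x A B
    using that by blast
  show "1 \<in> ?E"
    by (rule E[of _ 1 0]) (use FD in auto)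
  show "- x \<in> ?E" if x: "x \<in> ?E" for x
  proof -
    from x obtain A B where "x = A + B * w" "A \<in> F" "B \<in> F" by auto
    then show ?thesis by (intro E[of _ "- A" "- B"]) (use FD in auto)
  qed
  show "x + y \<in> ?E" if x: "x \<in> ?E" and y: "y \<in> ?E" for x y
  proof -
    from x obtain A B where "x = A + B * w" "A \<in> F" "B \<in> F" by auto
    moreover from y obtain C D where "y = C + D * w" "C \<in> F" "D \<in> F" by auto
    ultimately show ?thesis
      by (intro E[of _ "A + C" "B + D"]) (use FD in \<open>auto simp: algebra_simps\<close>)
  qed
  show "x * y \<in> ?E" if x: "x \<in> ?E" and y: "y \<in> ?E" for x y
  proof -
    from x obtain A B where "x = A + B * w" "A \<in> F" "B \<in> F" by auto
    moreover from y obtain C D where "y = C + D * w" "C \<in> F" "D \<in> F" by auto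
    ultimately show ?thesis
      by (intro E[of _ "A * C + B * D * (w * w)" "A * D + B * C"])
        (use FD w in \<open>auto simp: algebra_simps\<close>)
  qed
  show "inverse x \<in> ?E" if x: "x \<in> ?E" "x \<noteq> 0" for x
  proof -
    from x obtain A B where AB: "x = A + B * w" "A \<in> F" "B \<in> F" by auto
    show ?thesis
    proof (cases "A - B * w = 0")
      case True
      then have "x = A + A" using AB by simp
      then have "inverse x \<in> F" using FD(4)[OF FD(5)[OF AB(2,2)]] by simp
      then show ?thesis by (intro E[of _ "inverse x" 0]) (use FD in auto)
    next
      case False
      \<comment> \<open>\<open>N\<close> is the product of \<open>x\<close> and its conjugate
        \<open>A - B * w\<close>, both nonzero here; it lies in \<open>F\<close>, so this
        rationalises the denominator of \<open>inverse x\<close>.\<close>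
      define N where "N = A * A - B * B * (w * w)"
      have "N = x * (A - B * w)" by (simp add: N_def AB algebra_simps)
      then have "inverse x = (A - B * w) * inverse N" using False x by simp
      also have "\<dots> = A * inverse N + - (B * inverse N) * w" by (simp add: algebra_simps)
      finally show ?thesis
        using AB FD w diff unfolding N_def by (elim E) auto
    qed
  qed
qed

section \<open>Multiplication in the coordinates 1, s, t, u\<close>

definition lin_comb :: "'a::field_char_0 \<Rightarrow> 'a \<Rightarrow> 'a \<Rightarrow> rat \<Rightarrow> rat \<Rightarrow> rat \<Rightarrow> rat \<Rightarrow> 'a" where
  "lin_comb s t u a b c d = of_rat a + of_rat b * s + of_rat c * t + of_rat d * u"

text \<open>
  Here \<open>g = gcd p q\<close>, \<open>p = g h\<close>, \<open>q = g k\<close> and \<open>r = h k\<close>. The relations hold for the real square roots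
  and for their images under any embedding, so one multiplication rule serves for both.
\<close>

definition biquadratic_roots :: "nat \<Rightarrow> nat \<Rightarrow> nat \<Rightarrow> 'a::field_char_0 \<Rightarrow> 'a \<Rightarrow> 'a \<Rightarrow> bool" where
  "biquadratic_roots g h k s t u \<longleftrightarrow>
     s * s = of_nat (g * h) \<and> t * t = of_nat (g * k) \<and> u * u = of_nat (h * k) \<and>
     s * t = of_nat g * u \<and> s * u = of_nat h * t \<and> t * u = of_nat k * s"

lemma lin_comb_add:
  "lin_comb s t u a b c d + lin_comb s t u a' b' c' d' =
   lin_comb s t u (a + a') (b + b') (c + c') (d + d')"
  by (simp add: lin_comb_def of_rat_add algebra_simps)

lemma lin_comb_diff:
  "lin_comb s t u a b c d - lin_comb s t u a' b' c' d' =
   lin_comb s t u (a - a') (b - b') (c - c') (d - d')"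
  by (simp add: lin_comb_def of_rat_diff algebra_simps)

text \<open>The coefficients of the product depend only on \<open>g\<close>, \<open>h\<close>,
  \<open>k\<close> and the given coefficients. Replacing the roots by others that satisfy the same
  relations therefore respects multiplication.\<close>

lemma lin_comb_mult:
  assumes "biquadratic_roots g h k s t u"
  shows "lin_comb s t u a b c d * lin_comb s t u a' b' c' d' = lin_comb s t u
    (a * a' + of_nat (g * h) * (b * b') + of_nat (g * k) * (c * c') + of_nat (h * k) * (d * d'))
    (a * b' + b * a' + of_nat k * (c * d' + d * c'))
    (a * c' + c * a' + of_nat h * (b * d' + d * b'))
    (a * d' + d * a' + of_nat g * (b * c' + c * b'))"
proof -
  note R = assms[unfolded biquadratic_roots_def]
  have "lin_comb s t u a b c d * lin_comb s t u a' b' c' d' =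
    of_rat a * of_rat a' + of_rat b * of_rat b' * (s * s) + of_rat c * of_rat c' * (t * t)
    + of_rat d * of_rat d' * (u * u)
    + (of_rat a * of_rat b' + of_rat b * of_rat a') * s
    + (of_rat a * of_rat c' + of_rat c * of_rat a') * t
    + (of_rat a * of_rat d' + of_rat d * of_rat a') * u
    + (of_rat b * of_rat c' + of_rat c * of_rat b') * (s * t)
    + (of_rat b * of_rat d' + of_rat d * of_rat b') * (s * u)
    + (of_rat c * of_rat d' + of_rat d * of_rat c') * (t * u)"
    by (simp add: lin_comb_def algebra_simps)
  also have "\<dots> = lin_comb s t u
    (a * a' + of_nat (g * h) * (b * b') + of_nat (g * k) * (c * c') + of_nat (h * k) * (d * d'))
    (a * b' + b * a' + of_nat k * (c * d' + d * c'))
    (a * c' + c * a' + of_nat h * (b * d' + d * b'))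
    (a * d' + d * a' + of_nat g * (b * c' + c * b'))"
    using R by (simp add: lin_comb_def of_rat_add of_rat_mult algebra_simps)
  finally show ?thesis .
qed

lemma biquadratic_roots_of_real:
  assumes "biquadratic_roots g h k s t u"
  shows "biquadratic_roots g h k (complex_of_real s) (of_real t) (of_real u)"
proof -
  have "complex_of_real x * of_real y = of_nat n * of_real z" if "x * y = of_nat n * z" for x y z n
    using arg_cong[OF that, of complex_of_real] by simp
  moreover have "complex_of_real x * of_real y = of_nat n" if "x * y = of_nat n" for x y n
    using arg_cong[OF that, of complex_of_real] by simp
  ultimately show ?thesis
    using assms unfolding biquadratic_roots_def by blast
qed

section \<open>Embeddings and their action on the rationals\<close>

lemma embeddings_iff:
  "\<sigma> \<in> embeddings K \<longleftrightarrow> \<sigma> \<in> extensional K \<and> \<sigma> 1 = 1 \<and>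
    (\<forall>x\<in>K. \<forall>y\<in>K. \<sigma> (x + y) = \<sigma> x + \<sigma> y \<and> \<sigma> (x * y) = \<sigma> x * \<sigma> y)"
  by (auto simp: embeddings_def ring_hom_def)

text \<open>Additivity and \<open>\<sigma> 1 = 1\<close> fix the integers; multiplying a fraction by
  its nonzero denominator then reduces the claim to integers.\<close>

lemma embedding_of_rat:
  assumes K: "subfield K ring_of_type_algebra" and \<sigma>: "\<sigma> \<in> embeddings K"
  shows "\<sigma> (of_rat a) = of_rat a"
proof (cases a)
  case (Fract m n)
  note KD = subfield_type_algebraD[OF K]
  have add: "\<sigma> (x + y) = \<sigma> x + \<sigma> y" and mult: "\<sigma> (x * y) = \<sigma> x * \<sigma> y"
    if "x \<in> K" "y \<in> K" for x y
    using \<sigma> that by (auto simp: embeddings_iff)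
  have one: "\<sigma> 1 = 1" using \<sigma> by (simp add: embeddings_iff)
  have zero: "\<sigma> 0 = 0" using add[of 0 0] KD by simp
  have natK: "of_nat j \<in> K" for j
    using of_rat_in_subfield[OF K, of "of_nat j"] by simp
  have nat: "\<sigma> (of_nat j) = of_nat j" for j
    by (induction j) (use zero one add KD natK in auto)
  have intK: "of_int i \<in> K" for i
    using of_rat_in_subfield[OF K, of "of_int i"] by simp
  have int: "\<sigma> (of_int i) = of_int i" for i
  proof (cases "i \<ge> 0")
    case True
    then show ?thesis using nat[of "nat i"] by simp
  next
    case False
    then have "\<sigma> (of_int i) + \<sigma> (of_nat (nat (- i))) = 0"
      using add[OF intK[of i] natK[of "nat (- i)"]] zero by simp
    then show ?thesis using nat[of "nat (- i)"] False by (simp add: add_eq_0_iff)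
  qed
  have "a * of_int n = of_int m"
    using Fract by (simp add: Fract_of_int_quotient)
  from arg_cong[OF this, of of_rat]
  have real: "of_rat a * of_int n = (of_int m :: real)"
    and complex: "of_rat a * of_int n = (of_int m :: complex)"
    by (simp_all add: of_rat_mult)
  have "\<sigma> (of_rat a) * of_int n = \<sigma> (of_rat a * of_int n)"
    using mult[OF of_rat_in_subfield[OF K, of a] intK[of n]] int by simp
  also have "\<dots> = of_rat a * of_int n"
    unfolding real complex by (rule int)
  finally show ?thesis
    using Fract by simp
qed

section \<open>Rational coordinates in the biquadratic field\<close>

locale biquadratic_field =
  fixes g h k :: nat and K :: "real set"
  assumes pos: "g > 0" "h > 0" "k > 0"
    and K_eq: "K = adjoin_rat {sqrt (real (g * h)), sqrt (real (g * k))}"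
    and degree: "degree_over_rat K = 4"
begin

definition s :: real where "s = sqrt (real (g * h))"
definition t :: real where "t = sqrt (real (g * k))"
definition u :: real where "u = sqrt (real (h * k))"

lemma roots: "biquadratic_roots g h k s t u"
proof -
  have "sqrt (real m) * (sqrt (real m) * x) = real m * x" for m x
    by (simp flip: mult.assoc)
  then show ?thesis
    unfolding biquadratic_roots_def s_def t_def u_def
    by (simp add: real_sqrt_mult mult_ac)
qed

lemma nonzero: "s \<noteq> 0" "t \<noteq> 0" "u \<noteq> 0"
  using pos by (simp_all add: s_def t_def u_def)

lemma subfield_K: "subfield K ring_of_type_algebra"
  unfolding K_eq by (rule subfield_adjoin_rat)

lemmas K_closed = subfield_type_algebraD[OF subfield_K]

lemma K_diff: "x \<in> K \<Longrightarrow> y \<in> K \<Longrightarrow> x - y \<in> K"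
  using K_closed(3)[of y] K_closed(5)[of x "- y"] by simp

lemma roots_in_K: "s \<in> K" "t \<in> K" "u \<in> K"
proof -
  show st: "s \<in> K" "t \<in> K"
    using adjoin_rat_superset[of "{s, t}"] unfolding K_eq s_def t_def by auto
  have "u = s * t * inverse (of_rat (of_nat g))"
    using roots pos by (simp add: biquadratic_roots_def)
  then show "u \<in> K"
    using st K_closed of_rat_in_subfield[OF subfield_K, of "of_nat g"] by simp
qed

lemma lin_comb_in_K: "lin_comb s t u a b c d \<in> K"
  using roots_in_K K_closed of_rat_in_subfield[OF subfield_K] by (simp add: lin_comb_def)

text \<open>Two successive quadratic extensions of the rationals, by \<open>s\<close> and then by
  \<open>t\<close>, give a field containing both generators, hence all of \<open>K\<close>.
  Expanding leaves a term in \<open>s * t\<close>, which is \<open>g\<close> times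
  \<open>u\<close>.\<close>

lemma K_cases:
  assumes "x \<in> K"
  obtains a b c d where "x = lin_comb s t u a b c d"
proof -
  define F where "F = {A + B * s | A B. A \<in> \<rat> \<and> B \<in> \<rat>}"
  define E where "E = {A + B * t | A B. A \<in> F \<and> B \<in> F}"
  have Q: "subfield (\<rat> :: real set) ring_of_type_algebra"
    by (rule subfield_type_algebraI) auto
  have F: "subfield F ring_of_type_algebra"
    unfolding F_def
    by (rule subfield_adjoin_square_root[OF Q]) (use roots in \<open>simp add: biquadratic_roots_def\<close>)
  have "t * t = of_rat (of_nat (g * k))"
    using roots unfolding biquadratic_roots_def of_rat_of_nat_eq by blast
  then have E: "subfield E ring_of_type_algebra"
    unfolding E_def by (intro subfield_adjoin_square_root F) (simp only: of_rat_in_subfield[OF F])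
  have "s \<in> F"
    unfolding F_def by (rule CollectI, rule exI[of _ 0], rule exI[of _ 1]) auto
  then have "s \<in> E"
    unfolding E_def
    by (intro CollectI exI[of _ s] exI[of _ 0]) (use subfield_type_algebraD[OF F] in auto)
  moreover have "t \<in> E"
    unfolding E_def
    by (intro CollectI exI[of _ 0] exI[of _ 1]) (use subfield_type_algebraD[OF F] in auto)
  ultimately have "x \<in> E"
    using adjoin_rat_least[OF E, of "{s, t}"] assms by (auto simp: K_eq s_def t_def)
  then obtain a b c d where x: "x = (of_rat a + of_rat b * s) + (of_rat c + of_rat d * s) * t"
    unfolding E_def F_def Rats_def by auto
  also have "\<dots> = of_rat a + of_rat b * s + of_rat c * t + of_rat d * (s * t)"
    by (simp add: algebra_simps)
  also have "\<dots> = lin_comb s t u a b c (of_nat g * d)"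
    using roots by (simp add: biquadratic_roots_def lin_comb_def of_rat_mult)
  finally show ?thesis by (rule that)
qed

text \<open>This is where degree 4 enters: \<open>1, s, t, u\<close> span a space of dimension 4,
  and four vectors that do so must be independent.\<close>

lemma lin_comb_eq_0D:
  assumes "lin_comb s t u a b c d = 0"
  shows "a = 0 \<and> b = 0 \<and> c = 0 \<and> d = 0"
proof -
  interpret V: vector_space "\<lambda>(c::rat) (x::real). of_rat c * x"
    by unfold_locales (auto simp: algebra_simps of_rat_add of_rat_mult)
  let ?B = "{1, s, t, u}"
  have dim: "V.dim K = 4" using degree by (simp add: degree_over_rat_def)
  have "lin_comb s t u a b c d \<in> V.span ?B" for a b c d
  proof -
    have "of_rat a * 1 + of_rat b * s + of_rat c * t + of_rat d * u \<in> V.span ?B"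
      by (intro V.span_add V.span_scale V.span_base) auto
    then show ?thesis by (simp add: lin_comb_def)
  qed
  then have sub: "K \<subseteq> V.span ?B" by (auto elim!: K_cases)
  have "4 \<le> card ?B" using V.dim_le_card[OF sub] dim by simp
  \<comment> \<open>If two of the four listed elements coincided, fewer than four vectors would span
    \<open>K\<close>.\<close>
  then have card: "card ?B = 4"
    using card_insert_le_m1[of 4 "{s, t, u}" 1] card_insert_le_m1[of 3 "{t, u}" s]
      card_insert_le_m1[of 2 "{u}" t] by simp
  then have dist: "distinct [1, s, t, u]"
    using card_distinct[of "[1, s, t, u]"] by simp
  have ind: "V.independent ?B"
  proof (rule ccontr)
    assume "\<not> ?thesis"
    then obtain x where x: "x \<in> ?B" "x \<in> V.span (?B - {x})"
      unfolding V.dependent_def by blast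
    have "v \<in> V.span (?B - {x})" if "v \<in> ?B" for v
      using x(2) V.span_base[of v "?B - {x}"] that by blast
    then have "V.span ?B \<subseteq> V.span (?B - {x})"
      by (intro V.span_minimal V.subspace_span) blast
    then have "V.dim K \<le> card (?B - {x})"
      using sub by (intro V.dim_le_card) auto
    then show False using dim card x by (simp add: card_Diff_singleton)
  qed
  \<comment> \<open>Independence is phrased for a coefficient function on vectors; distinctness of
    the four vectors keeps the updates from overwriting each other.\<close>
  define f where "f = (\<lambda>_. 0)(1 := a, s := b, t := c, u := d)"
  have f: "f 1 = a" "f s = b" "f t = c" "f u = d"
    using dist by (auto simp: f_def)
  have "(\<Sum>v\<in>?B. of_rat (f v) * v) = 0"
    using assms dist f by (simp add: lin_comb_def add.assoc)
  then have "\<forall>v\<in>?B. f v = 0"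
    using V.independentD[OF ind _ subset_refl] by blast
  then show ?thesis using f by auto
qed

lemma lin_comb_inject:
  assumes "lin_comb s t u a b c d = lin_comb s t u a' b' c' d'"
  shows "a = a' \<and> b = b' \<and> c = c' \<and> d = d'"
  using lin_comb_eq_0D[of "a - a'" "b - b'" "c - c'" "d - d'"] assms
  by (simp flip: lin_comb_diff)

section \<open>The four embeddings of K\<close>

text \<open>Uniqueness of coordinates makes the \<open>THE\<close> well defined. The factor on
  \<open>u\<close> has to be \<open>e * f\<close> because \<open>s * t\<close> is a multiple of
  \<open>u\<close>, and \<open>restrict\<close> matches the extensionality required of
  embeddings.\<close>

definition conjugate :: "real \<Rightarrow> real \<Rightarrow> real \<Rightarrow> complex" where
  "conjugate e f = restrict (\<lambda>x. THE z. \<exists>a b c d. x = lin_comb s t u a b c d \<and>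
     z = lin_comb (of_real (e * s)) (of_real (f * t)) (of_real (e * f * u)) a b c d) K"

lemma conjugate_lin_comb:
  "conjugate e f (lin_comb s t u a b c d) =
     lin_comb (of_real (e * s)) (of_real (f * t)) (of_real (e * f * u)) a b c d"
  unfolding conjugate_def
  using lin_comb_in_K by (auto dest: lin_comb_inject intro!: the_equality)

lemma conjugate_roots:
  "conjugate e f s = of_real (e * s)" "conjugate e f t = of_real (f * t)"
  using conjugate_lin_comb[of e f 0 1 0 0] conjugate_lin_comb[of e f 0 0 1 0]
  by (simp_all add: lin_comb_def)

text \<open>As \<open>e\<close> and \<open>f\<close> square to 1, the roots with changed signs
  satisfy the same relations, so the multiplication rule has the same coefficients on both
  sides.\<close>

lemma conjugate_in_embeddings:
  assumes "e \<in> {1, -1}" "f \<in> {1, -1}"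
  shows "conjugate e f \<in> embeddings K"
proof -
  have "biquadratic_roots g h k (e * s) (f * t) (e * f * u)"
    using assms roots by (auto simp: biquadratic_roots_def)
  note R = biquadratic_roots_of_real[OF this]
  have "conjugate e f 1 = 1"
    using conjugate_lin_comb[of e f 1 0 0 0] by (simp add: lin_comb_def)
  moreover have "conjugate e f (x + y) = conjugate e f x + conjugate e f y \<and>
      conjugate e f (x * y) = conjugate e f x * conjugate e f y" if "x \<in> K" "y \<in> K" for x y
  proof -
    obtain a b c d where x: "x = lin_comb s t u a b c d"
      using K_cases[OF \<open>x \<in> K\<close>] .
    obtain a' b' c' d' where y: "y = lin_comb s t u a' b' c' d'"
      using K_cases[OF \<open>y \<in> K\<close>] .
    show ?thesis
      by (simp only: x y lin_comb_add lin_comb_mult[OF roots] lin_comb_mult[OF R]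
          conjugate_lin_comb)
  qed
  ultimately show ?thesis
    by (simp add: embeddings_iff conjugate_def)
qed

text \<open>An embedding is determined on \<open>K\<close> by its values at \<open>s\<close> and
  \<open>t\<close>, and each of these is a square root of a fixed natural number, leaving only a
  choice of sign.\<close>

lemma embedding_is_conjugate:
  assumes \<sigma>: "\<sigma> \<in> embeddings K"
  obtains e f where "e \<in> {1, -1}" "f \<in> {1, -1}" "\<sigma> = conjugate e f"
proof -
  have add: "\<sigma> (x + y) = \<sigma> x + \<sigma> y" and mult: "\<sigma> (x * y) = \<sigma> x * \<sigma> y"
    if "x \<in> K" "y \<in> K" for x y
    using \<sigma> that by (auto simp: embeddings_iff)
  note rat = embedding_of_rat[OF subfield_K \<sigma>]
  note ratK = of_rat_in_subfield[OF subfield_K]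
  have sign: "\<exists>e\<in>{1, -1}. \<sigma> w = of_real (e * w)" if w: "w \<in> K" "w * w = of_nat m" for w m
  proof -
    have "\<sigma> w * \<sigma> w = of_real (w * w)"
      using mult[OF w(1,1)] rat[of "of_nat m"] w(2) by (simp only: of_rat_of_nat_eq of_real_of_nat_eq)
    then have "\<sigma> w = of_real w \<or> \<sigma> w = - of_real w"
      by (simp add: square_eq_iff)
    then show ?thesis by auto
  qed
  obtain e where e: "e \<in> {1, -1}" "\<sigma> s = of_real (e * s)"
    using sign[OF roots_in_K(1), of "g * h"] roots unfolding biquadratic_roots_def by blast
  obtain f where f: "f \<in> {1, -1}" "\<sigma> t = of_real (f * t)"
    using sign[OF roots_in_K(2), of "g * k"] roots unfolding biquadratic_roots_def by blast
  have st: "s * t = of_rat (of_nat g) * u"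
    using roots by (simp add: biquadratic_roots_def)
  \<comment> \<open>The sign at \<open>u\<close> is not free: it follows from \<open>s * t\<close>
    being \<open>g\<close> times \<open>u\<close>, with \<open>g\<close> nonzero.\<close>
  have "of_nat g * \<sigma> u = \<sigma> s * \<sigma> t"
    using mult[OF ratK[of "of_nat g"] roots_in_K(3)] mult[OF roots_in_K(1,2)] rat[of "of_nat g"] st
    by simp
  also have "\<dots> = of_real (e * f * (s * t))"
    using e f by simp
  also have "\<dots> = of_nat g * of_real (e * f * u)"
    using st by simp
  finally have u: "\<sigma> u = of_real (e * f * u)"
    using pos by simp
  have "\<sigma> x = conjugate e f x" for x
  proof (cases "x \<in> K")
    case True
    then obtain a b c d where x: "x = lin_comb s t u a b c d"
      by (rule K_cases)
    have "\<sigma> x = lin_comb (\<sigma> s) (\<sigma> t) (\<sigma> u) a b c d"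
      unfolding x lin_comb_def
      by (simp add: add mult rat ratK roots_in_K K_closed)
    then show ?thesis
      by (simp only: e f u x conjugate_lin_comb)
  next
    case False
    then show ?thesis
      using \<sigma> by (auto simp: embeddings_iff conjugate_def extensional_def)
  qed
  then have "\<sigma> = conjugate e f" by blast
  with e f show ?thesis using that by blast
qed

lemma embeddings_eq: "embeddings K = (\<lambda>(e, f). conjugate e f) ` ({1, -1} \<times> {1, -1})"
proof (intro equalityI subsetI)
  fix \<sigma> assume "\<sigma> \<in> embeddings K"
  then show "\<sigma> \<in> (\<lambda>(e, f). conjugate e f) ` ({1, -1} \<times> {1, -1})"
    by (rule embedding_is_conjugate) force
qed (auto simp: conjugate_in_embeddings)

text \<open>The values at the nonzero roots \<open>s\<close> and \<open>t\<close> recover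
  \<open>e\<close> and \<open>f\<close>. Thus different sign pairs give different embeddings, and a
  sum over embeddings has four terms.\<close>

lemma inj_conjugate: "inj (\<lambda>(e, f). conjugate e f)"
proof (rule injI, clarify)
  fix e f e' f' assume "conjugate e f = conjugate e' f'"
  then show "e = e' \<and> f = f'"
    using conjugate_roots[of e f] conjugate_roots[of e' f'] nonzero by (simp flip: of_real_mult)
qed

section \<open>The trace in coordinates\<close>

text \<open>Over the four sign pairs, each of \<open>e\<close>, \<open>f\<close> and
  \<open>e * f\<close> is twice 1 and twice -1, so the irrational parts cancel.\<close>

lemma sum_embeddings:
  "(\<Sum>\<sigma>\<in>embeddings K. \<sigma> (lin_comb s t u a b c d)) = of_rat (4 * a)"
proof -
  have "(\<Sum>\<sigma>\<in>embeddings K. \<sigma> (lin_comb s t u a b c d)) =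
      (\<Sum>(e, f)\<in>{1, -1} \<times> {1, -1}. conjugate e f (lin_comb s t u a b c d))"
    unfolding embeddings_eq
    by (subst sum.reindex[OF inj_on_subset[OF inj_conjugate subset_UNIV]])
      (simp only: o_def case_prod_unfold)
  also have "\<dots> = of_rat (4 * a)"
    by (simp add: sum.cartesian_product[symmetric] conjugate_lin_comb)
      (simp add: lin_comb_def of_rat_mult)
  finally show ?thesis .
qed

lemma field_trace_lin_comb: "field_trace K (lin_comb s t u a b c d) = 4 * a"
  unfolding field_trace_def sum_embeddings by simp

lemma field_trace_diff:
  assumes "x \<in> K" "y \<in> K"
  shows "field_trace K (x - y) = field_trace K x - field_trace K y"
  using assms by (elim K_cases) (simp add: lin_comb_diff field_trace_lin_comb)

text \<open>The trace sees only the rational coordinate of the square; the mixed products contribute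
  to the coordinates of \<open>s\<close>, \<open>t\<close>, \<open>u\<close> alone.\<close>

lemma field_trace_power2:
  "field_trace K ((lin_comb s t u a b c d)\<^sup>2) =
     4 * (a\<^sup>2 + of_nat (g * h) * b\<^sup>2 + of_nat (g * k) * c\<^sup>2 + of_nat (h * k) * d\<^sup>2)"
  by (simp only: power2_eq_square lin_comb_mult[OF roots] field_trace_lin_comb)

lemma field_trace_pos:
  assumes "x \<in> K" "totally_positive K x"
  shows "field_trace K x > 0"
proof -
  obtain a b c d where x: "x = lin_comb s t u a b c d"
    using K_cases[OF \<open>x \<in> K\<close>] .
  have "0 < (\<Sum>\<sigma>\<in>embeddings K. \<sigma> x)"
  proof (rule sum_pos)
    show "finite (embeddings K)" "embeddings K \<noteq> {}"
      by (simp_all add: embeddings_eq)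
  qed (use assms in \<open>auto simp: totally_positive_def\<close>)
  \<comment> \<open>Taking real parts moves positivity from the complex order to the reals, and from
    there to \<open>rat\<close>.\<close>
  then have "Re (of_rat (4 * a)) > 0"
    unfolding x sum_embeddings by (simp add: less_complex_def)
  also have "Re (of_rat (4 * a)) = of_rat (4 * a)"
    by (cases a) (simp add: Fract_of_int_quotient of_rat_divide of_rat_mult)
  finally show ?thesis
    by (simp add: x field_trace_lin_comb)
qed

text \<open>Total positivity would be vacuous without embeddings; their existence is what excludes a
  totally positive zero.\<close>

lemma embeddings_nonempty: "embeddings K \<noteq> {}"
  by (simp add: embeddings_eq)

end

section \<open>Restriction to two variables and the 2 by 2 minors\<close>

lemma quad_form_two_variables:
  assumes "i \<in> {1..n}" "j \<in> {1..n}" "i \<noteq> j" "\<alpha> i j = \<alpha> j i"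
  shows "quad_form n \<alpha> (\<lambda>m. if m = i then x else if m = j then y else 0) =
    \<alpha> i i * x\<^sup>2 + 2 * \<alpha> i j * x * y + \<alpha> j j * y\<^sup>2"
proof -
  let ?v = "\<lambda>m. if m = i then x else if m = j then y else 0"
  have sum2: "(\<Sum>m\<in>{1..n}. F m) = F i + F j" if "\<And>m. m \<noteq> i \<Longrightarrow> m \<noteq> j \<Longrightarrow> F m = 0"
    for F :: "nat \<Rightarrow> real"
  proof -
    have "(\<Sum>m\<in>{1..n}. F m) = (\<Sum>m\<in>{i, j}. F m)"
      by (rule sum.mono_neutral_right) (use assms that in auto)
    then show ?thesis using assms by simp
  qed
  have "quad_form n \<alpha> ?v = (\<Sum>a\<in>{1..n}. \<alpha> a i * ?v a * x + \<alpha> a j * ?v a * y)"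
    unfolding quad_form_def by (rule sum.cong[OF refl], subst sum2) (use assms in auto)
  also have "\<dots> = \<alpha> i i * x\<^sup>2 + 2 * \<alpha> i j * x * y + \<alpha> j j * y\<^sup>2"
    by (subst sum2) (use assms in \<open>auto simp: power2_eq_square\<close>)
  finally show ?thesis .
qed

text \<open>
  The vector \<open>- \<alpha>\<^sub>i\<^sub>j e\<^sub>i + \<alpha>\<^sub>i\<^sub>i e\<^sub>j\<close> is integral, and the form takes the value
  \<open>\<alpha>\<^sub>i\<^sub>i (\<alpha>\<^sub>i\<^sub>i \<alpha>\<^sub>j\<^sub>j - \<alpha>\<^sub>i\<^sub>j\<^sup>2)\<close> there.
\<close>

lemma totally_positive_definite_minor:
  assumes K: "subfield K ring_of_type_algebra" and ne: "embeddings K \<noteq> {}"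
    and cl: "classical_form K n \<alpha>" and pd: "totally_positive_definite K n \<alpha>"
    and ij: "i \<in> {1..n}" "j \<in> {1..n}" "i \<noteq> j"
  shows "totally_less K ((\<alpha> i j)\<^sup>2) (\<alpha> i i * \<alpha> j j)"
proof -
  note KD = subfield_type_algebraD[OF K]
  let ?v = "\<lambda>x y m. if m = i then x else if m = j then y else (0::real)"
  have sym: "\<alpha> i j = \<alpha> j i" using cl ij by (auto simp: classical_form_def)
  have int: "\<alpha> i i \<in> ring_of_integers K" "\<alpha> i j \<in> ring_of_integers K" "\<alpha> j j \<in> ring_of_integers K"
    using cl ij by (auto simp: classical_form_def)
  then have inK: "\<alpha> i i \<in> K" "\<alpha> i j \<in> K" "\<alpha> j j \<in> K"
    by (auto simp: ring_of_integers_def)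
  have val: "totally_positive K (\<alpha> i i * x\<^sup>2 + 2 * \<alpha> i j * x * y + \<alpha> j j * y\<^sup>2)"
    if "x \<in> ring_of_integers K" "y \<in> ring_of_integers K" "x \<noteq> 0 \<or> y \<noteq> 0" for x y
  proof -
    have "\<exists>m\<in>{1..n}. ?v x y m \<noteq> 0"
      using that ij by (intro bexI[of _ "if x \<noteq> 0 then i else j"]) auto
    moreover have "\<forall>m\<in>{1..n}. ?v x y m \<in> ring_of_integers K"
      using that KD(1) by (auto simp: ring_of_integers_def)
    ultimately have "totally_positive K (quad_form n \<alpha> (?v x y))"
      using pd[unfolded totally_positive_definite_def, rule_format, of "?v x y"] by simp
    then show ?thesis
      by (simp only: quad_form_two_variables[OF ij sym])
  qed
  \<comment> \<open>This is the value of the form at the \<open>i\<close>-th unit vector.\<close>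
  have diag: "totally_positive K (\<alpha> i i)"
    using val[of 1 0] KD by (simp add: ring_of_integers_def)
  \<comment> \<open>\<open>\<alpha> i i\<close> becomes the \<open>j\<close>-th coordinate of the
    test vector, so this makes that vector nonzero even when
    \<open>\<alpha> i j = 0\<close>.\<close>
  have "\<alpha> i i \<noteq> 0"
  proof
    assume "\<alpha> i i = 0"
    moreover obtain \<sigma> where \<sigma>: "\<sigma> \<in> embeddings K" using ne by blast
    moreover have "\<sigma> 0 = 0"
      using embedding_of_rat[OF K \<sigma>, of 0] by simp
    ultimately show False using diag by (auto simp: totally_positive_def)
  qed
  moreover have "- \<alpha> i j \<in> ring_of_integers K"
    using int KD by (auto simp: ring_of_integers_def)
  ultimately have "totally_positive K
      (\<alpha> i i * (- \<alpha> i j)\<^sup>2 + 2 * \<alpha> i j * (- \<alpha> i j) * \<alpha> i i + \<alpha> j j * (\<alpha> i i)\<^sup>2)"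
    using int by (intro val) auto
  also have "\<alpha> i i * (- \<alpha> i j)\<^sup>2 + 2 * \<alpha> i j * (- \<alpha> i j) * \<alpha> i i + \<alpha> j j * (\<alpha> i i)\<^sup>2 =
      \<alpha> i i * (\<alpha> i i * \<alpha> j j - (\<alpha> i j)\<^sup>2)"
    by (simp add: power2_eq_square algebra_simps)
  finally have prod: "totally_positive K (\<alpha> i i * (\<alpha> i i * \<alpha> j j - (\<alpha> i j)\<^sup>2))" .
  have minorK: "\<alpha> i i * \<alpha> j j - (\<alpha> i j)\<^sup>2 \<in> K"
    using KD(5)[OF KD(6)[OF inK(1,3)] KD(3)[OF KD(6)[OF inK(2,2)]]]
    by (simp add: power2_eq_square)
  show ?thesis
    unfolding totally_less_def totally_positive_def
  proof
    fix \<sigma> assume \<sigma>: "\<sigma> \<in> embeddings K"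
    \<comment> \<open>Under each embedding the product and its first factor are positive reals, so
      the second factor is real and positive too.\<close>
    have "0 < \<sigma> (\<alpha> i i)"
      using diag \<sigma> by (simp add: totally_positive_def)
    moreover have "0 < \<sigma> (\<alpha> i i) * \<sigma> (\<alpha> i i * \<alpha> j j - (\<alpha> i j)\<^sup>2)"
      using prod \<sigma> inK minorK by (simp add: totally_positive_def embeddings_iff)
    ultimately show "0 < \<sigma> (\<alpha> i i * \<alpha> j j - (\<alpha> i j)\<^sup>2)"
      by (auto simp: less_complex_def zero_less_mult_iff)
  qed
qed

section \<open>The minor inequality and the coefficient bounds\<close>

theorem proposition4p4:
  fixes p q r n :: nat and K :: "real set" and \<alpha> :: "nat \<Rightarrow> nat \<Rightarrow> real"
  assumes "p > 0" and "q > 0" and "squarefree p" and "squarefree q"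
    and "K = adjoin_rat {sqrt (real p), sqrt (real q)}"
    and "degree_over_rat K = 4"
    and "r = (p * q) div (gcd p q)\<^sup>2"
    and "classical_form K n \<alpha>"
    and "totally_positive_definite K n \<alpha>"
  shows "\<forall>i\<in>{1..n}. \<forall>j\<in>{1..n}. i \<noteq> j \<longrightarrow>
    totally_less K ((\<alpha> i j)\<^sup>2) (\<alpha> i i * \<alpha> j j) \<and>
    (\<forall>a b c d :: rat.
      \<alpha> i j = of_rat a + of_rat b * sqrt (real p) + of_rat c * sqrt (real q)
              + of_rat d * sqrt (real r) \<longrightarrow>
      a\<^sup>2 \<le> 1 / 4 * field_trace K (\<alpha> i i * \<alpha> j j) \<and>
      b\<^sup>2 \<le> 1 / (4 * of_nat p) * field_trace K (\<alpha> i i * \<alpha> j j) \<and>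
      c\<^sup>2 \<le> 1 / (4 * of_nat q) * field_trace K (\<alpha> i i * \<alpha> j j) \<and>
      d\<^sup>2 \<le> 1 / (4 * of_nat r) * field_trace K (\<alpha> i i * \<alpha> j j))"
proof (intro ballI impI conjI[OF _ allI[OF allI[OF allI[OF allI[OF impI]]]]])
  define g where "g = gcd p q"
  define h where "h = p div g"
  define k where "k = q div g"
  have p: "p = g * h" and q: "q = g * k"
    by (simp_all add: g_def h_def k_def)
  have g: "g > 0" using \<open>p > 0\<close> by (simp add: g_def)
  have hk: "h > 0" "k > 0" using p q \<open>p > 0\<close> \<open>q > 0\<close> by auto
  \<comment> \<open>The natural-number division defining \<open>r\<close> is therefore
    exact.\<close>
  have "p * q = g\<^sup>2 * (h * k)" by (simp add: p q power2_eq_square)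
  then have r: "r = h * k" using assms(7) g by (simp add: g_def[symmetric])
  interpret biquadratic_field g h k K
    by unfold_locales (use g hk assms p q in auto)
  fix i j assume ij: "i \<in> {1..n}" "j \<in> {1..n}" "i \<noteq> j"
  show less: "totally_less K ((\<alpha> i j)\<^sup>2) (\<alpha> i i * \<alpha> j j)"
    using assms ij by (intro totally_positive_definite_minor subfield_K embeddings_nonempty)
  fix a b c d
  assume \<alpha>: "\<alpha> i j = of_rat a + of_rat b * sqrt (real p) + of_rat c * sqrt (real q)
              + of_rat d * sqrt (real r)"
  have inK: "\<alpha> i i \<in> K" "\<alpha> i j \<in> K" "\<alpha> j j \<in> K"
    using assms(8) ij by (auto simp: classical_form_def ring_of_integers_def)
  then have sq: "(\<alpha> i j)\<^sup>2 \<in> K" and prod: "\<alpha> i i * \<alpha> j j \<in> K"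
    by (auto simp: power2_eq_square intro: K_closed)
  define T where "T = field_trace K (\<alpha> i i * \<alpha> j j)"
  have "\<alpha> i j = lin_comb s t u a b c d"
    by (simp only: \<alpha> lin_comb_def s_def t_def u_def p q r)
  then have tr: "field_trace K ((\<alpha> i j)\<^sup>2) =
      4 * (a\<^sup>2 + of_nat p * b\<^sup>2 + of_nat q * c\<^sup>2 + of_nat r * d\<^sup>2)"
    by (simp only: field_trace_power2 p q r)
  have "field_trace K (\<alpha> i i * \<alpha> j j - (\<alpha> i j)\<^sup>2) > 0"
    using less by (intro field_trace_pos K_diff sq prod) (simp add: totally_less_def)
  then have bound: "4 * (a\<^sup>2 + of_nat p * b\<^sup>2 + of_nat q * c\<^sup>2 + of_nat r * d\<^sup>2) < T"
    by (simp only: field_trace_diff[OF prod sq] tr T_def diff_gt_0_iff_gt)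
  \<comment> \<open>Any single summand is at most the whole sum, since the other three are
    nonnegative.\<close>
  have "4 * w \<le> T \<and> 4 * x \<le> T \<and> 4 * y \<le> T \<and> 4 * z \<le> T"
    if "4 * (w + x + y + z) < T" "0 \<le> w" "0 \<le> x" "0 \<le> y" "0 \<le> z" for w x y z
    using that by simp
  from this[OF bound] have bounds: "4 * a\<^sup>2 \<le> T" "4 * (of_nat p * b\<^sup>2) \<le> T"
    "4 * (of_nat q * c\<^sup>2) \<le> T" "4 * (of_nat r * d\<^sup>2) \<le> T"
    by simp_all
  \<comment> \<open>Positivity allows clearing the denominator \<open>4 * of_nat r\<close>; at
    \<open>r = 0\<close> the quotient would take the default value 0.\<close>
  have "r > 0" using r hk by simp
  have coeff: "x\<^sup>2 \<le> 1 / (4 * of_nat m) * T" if "4 * (of_nat m * x\<^sup>2) \<le> T" "m > 0" for x m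
    using that by (simp add: field_simps)
  show "a\<^sup>2 \<le> 1 / 4 * field_trace K (\<alpha> i i * \<alpha> j j) \<and>
      b\<^sup>2 \<le> 1 / (4 * of_nat p) * field_trace K (\<alpha> i i * \<alpha> j j) \<and>
      c\<^sup>2 \<le> 1 / (4 * of_nat q) * field_trace K (\<alpha> i i * \<alpha> j j) \<and>
      d\<^sup>2 \<le> 1 / (4 * of_nat r) * field_trace K (\<alpha> i i * \<alpha> j j)"
    unfolding T_def[symmetric]
    using bounds \<open>r > 0\<close> coeff[of p b] coeff[of q c] coeff[of r d] \<open>p > 0\<close> \<open>q > 0\<close>
    by simp
qed

end
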